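(* Let $d\ge1$ be an integer, $p\in(1,\infty)$, $c>0$, and let $X$ be a linear subspace of $M_d(\mathbb R)$ such that: 1. for all matrices $R\in M_d(\mathbb R)$ of rank one, $\|P_X(R)\|\ge\frac1c\|Q_X(R)\|$; 2. there exist $A\in X$ and $B\in X^\perp$ such that $\|A\|=\|B\|=1$ and $\mathrm{rank}(A+cB)=\mathrm{rank}(A-cB)=1$. Then, for $C\ge0$, the function $$f(A)=C^p\|P_X(A)\|^p-\|Q_X(A)\|^p,\qquad A\in M_d(\mathbb R),$$ has real-valued rank-one convex envelope if and only if $C\ge c(p^*-1)$, where $p^*=\max\big(p,\frac p{p-1}\big)$.
   Context: $M_d(\mathbb R)$, the space of real $d\times d$ matrices, carries the Frobenius inner product $\langle A,B\rangle=\mathrm{Tr}(AB^t)$ and norm $\|A\|^2=\mathrm{Tr}(AA^t)$. $P_X$ and $Q_X$ are the orthogonal projections onto $X$ and $X^\perp$ respectively. A function $g\colon M_d(\mathbb R)\to\mathbb R$ is rank-one convex if it is convex on each segment joining two matrices $A,B$ with $\mathrm{rank}(A-B)=1$. The rank-one convex envelope of $f$ is $f^{rc}(A)=\sup\{g(A): g\le f,\ g \text{ rank-one convex}\}$ (with $\sup\emptyset=-\infty$). *)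

theory Defs
  imports "HOL-Analysis.Analysis"
begin

text \<open>
  Real square matrices are elements of \<open>real^'n^'n\<close> with \<open>d = CARD('n) \<ge> 1\<close>. The inner product
  and norm that this type carries in the library are the Frobenius ones:
\<close>

lemma inner_matrix_eq_trace:
  fixes A B :: "real^'n^'n"
  shows "A \<bullet> B = trace (A ** transpose B)"
  by (simp add: inner_vec_def trace_def matrix_matrix_mult_def transpose_def)

lemma norm_matrix_eq_trace:
  fixes A :: "real^'n^'n"
  shows "(norm A)\<^sup>2 = trace (A ** transpose A)"
  by (simp add: power2_norm_eq_inner inner_matrix_eq_trace)

definition orth_proj :: "'a::euclidean_space set \<Rightarrow> 'a \<Rightarrow> 'a" where
  "orth_proj X x = (THE y. y \<in> X \<and> x - y \<in> orthogonal_comp X)"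

lemma orth_proj_ex1:
  fixes X :: "'a::euclidean_space set"
  assumes "subspace X"
  shows "\<exists>!y. y \<in> X \<and> x - y \<in> orthogonal_comp X"
proof -
  obtain y z where yz: "y \<in> span X" "\<And>w. w \<in> span X \<Longrightarrow> orthogonal z w" "x = y + z"
    using orthogonal_subspace_decomp_exists[of X x] by metis
  have "y \<in> X" and "x - y \<in> orthogonal_comp X"
    using yz assms by (auto simp: orthogonal_comp_def orthogonal_commute span_eq_iff[THEN iffD2])
  moreover have "y' = y''"
    if "y' \<in> X" "x - y' \<in> orthogonal_comp X" "y'' \<in> X" "x - y'' \<in> orthogonal_comp X" for y' y''
  proof -
    have X: "y' - y'' \<in> X"
      using that assms by (simp add: subspace_diff)
    have "(x - y'') - (x - y') \<in> orthogonal_comp X"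
      by (rule subspace_diff[OF subspace_orthogonal_comp that(4) that(2)])
    hence "y' - y'' \<in> orthogonal_comp X" by simp
    with X have "orthogonal (y' - y'') (y' - y'')"
      by (simp add: orthogonal_comp_def)
    thus ?thesis by (simp add: orthogonal_self)
  qed
  ultimately show ?thesis by blast
qed

definition rank_one_convex :: "(real^'n^'n \<Rightarrow> real) \<Rightarrow> bool" where
  "rank_one_convex g \<longleftrightarrow>
     (\<forall>A B. rank (A - B) = 1 \<longrightarrow> convex_on (closed_segment A B) g)"

text \<open>The supremum is taken in \<open>ereal\<close>, where the supremum of the empty set is \<open>-\<infinity>\<close>.\<close>

definition rc_envelope :: "(real^'n^'n \<Rightarrow> real) \<Rightarrow> real^'n^'n \<Rightarrow> ereal" where
  "rc_envelope f A = Sup {ereal (g A) |g. (\<forall>M. g M \<le> f M) \<and> rank_one_convex g}"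

end

theory Submission
  imports Defs
begin

text \<open>
  If some rank-one convex \<open>g\<close> lies below \<open>f\<close>, then \<open>f\<^sup>r\<^sup>c\<close> is squeezed between \<open>g\<close> and \<open>f\<close>;
  otherwise it is \<open>-\<infinity>\<close> everywhere (\<open>rc_envelope_real_iff\<close>). So the question is for which \<open>C\<close> the
  function \<open>f\<close> has a rank-one convex minorant. The constant \<open>p\<^sup>* - 1\<close> enters as Burkholder's best
  constant for differentially subordinate martingales.

  If \<open>C \<ge> c (p\<^sup>* - 1)\<close>, a minorant is a positive multiple of Burkholder's function of \<open>c P\<^sub>X A\<close> and
  \<open>Q\<^sub>X A\<close>, up to sign and order of the arguments (\<open>ex_rank_one_convex_minorant\<close>). By the hypothesis
  on rank-one matrices, in every rank-one direction \<open>Q\<^sub>X\<close> moves no faster than \<open>c P\<^sub>X\<close>, and along such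
  lines this function is convex (\<open>convex_burkholder_line\<close> for \<open>p \<ge> 2\<close>, \<open>convex_neg_burkholder_line\<close>
  for \<open>p \<le> 2\<close>). It lies below \<open>f\<close> because on the segment \<open>u + v = 1\<close> Burkholder's function is, up to
  a positive factor, the tangent line of \<open>(p - 1)\<^sup>p u\<^sup>p - v\<^sup>p\<close> at the zero of that function, and the
  tangent lies below the function for \<open>p \<ge> 2\<close> and above it for \<open>p \<le> 2\<close> (\<open>burkholder_tangent\<close>,
  \<open>burkholder_majorization\<close>).

  Conversely, restrict a minorant to the plane spanned by \<open>A\<close> and \<open>c B\<close>. In these coordinates
  \<open>(x, y)\<close> it is convex along both diagonal directions and lies below
  \<open>\<phi> x y = C\<^sup>p \<bar>x\<bar>\<^sup>p - c\<^sup>p \<bar>y\<bar>\<^sup>p\<close>. If \<open>\<phi>\<close> were negative at \<open>(1/p, 1 - 1/p)\<close>, then a zigzag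
  that climbs the axis in geometric steps, splitting off at each step a little mass onto two rays where
  \<open>\<phi> < 0\<close>, would make the minorant exceed \<open>\<phi>\<close> far out on the axis (\<open>zigzag_necessary\<close>).
  Hence \<open>C \<ge> c (p - 1)\<close>, and exchanging the roles of the axes gives \<open>C \<ge> c / (p - 1)\<close>; the larger
  of the two bounds is \<open>c (p\<^sup>* - 1)\<close>.
\<close>

section \<open>Zigzags: a lower bound for functions above diagonally convex ones\<close>

text \<open>
  Two uses of convexity move the point \<open>(0, y)\<close> up to \<open>(0, r y)\<close>. The first splits it along the direction
  \<open>(1, -1)\<close> into \<open>(L y, (1 - L) y)\<close> and a point slightly to the left of the axis; the second splits the
  latter along \<open>(1, 1)\<close> into \<open>(0, r y)\<close> and the point \<open>(- r L y, r (1 - L) y)\<close> of the mirrored ray, whose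
  nonpositive contribution is dropped from the estimate. The value of \<open>L\<close> is the one for which
  \<open>(0, r y)\<close> gets weight exactly \<open>r\<^sup>-\<^sup>p\<close>, so that the step loses nothing for \<open>p\<close>-homogeneous functions on the axis.
\<close>

lemma zigzag_step:
  fixes h \<phi> :: "real \<Rightarrow> real \<Rightarrow> real" and p r y L :: real
  assumes p: "1 < p" and r: "1 < r" and y: "0 < y"
    and conv_plus: "\<And>x y. convex_on UNIV (\<lambda>t. h (x + t) (y + t))"
    and conv_minus: "\<And>x y. convex_on UNIV (\<lambda>t. h (x + t) (y - t))"
    and le: "\<And>x y. h x y \<le> \<phi> x y"
    and hom: "\<And>s x y. 0 < s \<Longrightarrow> \<phi> (s * x) (s * y) = s powr p * \<phi> x y"
    and even: "\<And>x y. \<phi> (- x) y = \<phi> x y"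
    and L: "L = (r - 1) / 2 * (1 + r powr (p - 1)) / (r powr p - 1)"
    and neg: "\<phi> L (1 - L) \<le> 0"
  shows "h 0 y \<le> (r powr p - 1) / (r powr (p - 1) + r powr p) * (y powr p * \<phi> L (1 - L))
                 + h 0 (r * y) / r powr p"
proof -
  define \<delta> where "\<delta> = (r - 1) / 2"
  define m where "m = r powr (p - 1)"
  have m: "1 < m" unfolding m_def using p r by (simp add: gr_one_powr)
  have rp: "r powr p = r * m" using r by (simp add: m_def powr_diff)
  have rm: "1 < r * m" using m r by (metis less_1_mult)
  have \<delta>: "0 < \<delta>" "r = 1 + 2 * \<delta>" using r by (auto simp: \<delta>_def field_simps)
  have L': "L = \<delta> * (1 + m) / (r * m - 1)" using L by (simp add: \<delta>_def m_def[symmetric] rp)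
  have Lpos: "0 < L" using \<delta> m rm by (simp add: L')
  have gap: "r * L - \<delta> = \<delta> * (r + 1) / (r * m - 1)" using rm by (simp add: L' field_simps)
  have gap_pos: "0 < r * L - \<delta>" unfolding gap using \<delta>(1) rm r by (intro divide_pos_pos mult_pos_pos) auto
  \<comment> \<open>Weight of the ray point in the first splitting.\<close>
  define w where "w = \<delta> / (\<delta> + L)"
  have w: "0 < w" "w < 1" using \<delta> Lpos by (auto simp: w_def)
  \<comment> \<open>Weight of the left ray point in the second splitting.\<close>
  define v where "v = \<delta> / (r * L)"
  have v: "0 < v" "v < 1" using \<delta> Lpos gap_pos r by (auto simp: v_def)
  have dL: "\<delta> + L = \<delta> * (m + r * m) / (r * m - 1)" using rm by (simp add: L' field_simps)
  have wval: "w = (r powr p - 1) / (r powr (p - 1) + r powr p)"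
    unfolding w_def dL rp m_def[symmetric] using \<delta>(1) rm by simp
  have v1: "1 - v = (r * L - \<delta>) / (r * L)" using r Lpos by (simp add: v_def field_simps)
  have cancel: "(\<delta> * a / (r * m - 1)) / (b * (\<delta> * c / (r * m - 1))) = a / (b * c)" for a b c
    using \<delta>(1) rm by simp
  have u: "1 - v = (r + 1) / (r * (1 + m))"
    unfolding v1 gap unfolding L' using cancel[of "r + 1" r "1 + m"] .
  have "1 - w = L / (\<delta> + L)" using \<delta> Lpos by (simp add: w_def field_simps)
  then have w': "1 - w = (1 + m) / (m + r * m)"
    unfolding dL unfolding L' using cancel[of "1 + m" 1 "m + r * m"] by simp
  have weights: "(1 - w) * (1 - v) = 1 / r powr p"
  proof -
    have "m + r * m = m * (r + 1)" by (simp add: algebra_simps)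
    then have "(1 + m) / (m + r * m) * ((r + 1) / (r * (1 + m))) = 1 / (r * m)" using m r by simp
    then show ?thesis using u w' by (simp add: rp)
  qed
  have leg1: "h 0 y \<le> (1 - w) * h (0 - \<delta> * y) (y + \<delta> * y) + w * h (L * y) (y - L * y)"
  proof -
    have e: "(1 - w) *\<^sub>R (- (\<delta> * y)) + w *\<^sub>R (L * y) = 0" using \<delta> Lpos by (simp add: w_def field_simps)
    then show ?thesis
      using convex_onD[OF conv_minus[of 0 y], of w "- (\<delta> * y)" "L * y"] w unfolding e by simp
  qed
  have leg2: "h (0 - \<delta> * y) (y + \<delta> * y)
      \<le> (1 - v) * h 0 (r * y) + v * h (- (r * L * y)) (r * y - r * L * y)"
  proof -
    have e: "(1 - v) *\<^sub>R 0 + v *\<^sub>R (- (r * L * y)) = - (\<delta> * y)" using r Lpos by (simp add: v_def)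
    have f: "r * y + - (\<delta> * y) = y + \<delta> * y" by (simp add: \<delta> algebra_simps)
    show ?thesis
      using convex_onD[OF conv_plus[of 0 "r * y"], of v 0 "- (r * L * y)"] v unfolding e f by simp
  qed
  have right: "h (L * y) (y - L * y) \<le> y powr p * \<phi> L (1 - L)"
    using le[of "L * y" "y - L * y"] hom[OF y, of L "1 - L"] by (simp add: algebra_simps)
  have left: "h (- (r * L * y)) (r * y - r * L * y) \<le> 0"
  proof -
    have "\<phi> (- (r * L * y)) (r * y - r * L * y) = \<phi> ((r * y) * L) ((r * y) * (1 - L))"
      unfolding even by (simp add: algebra_simps)
    also have "\<dots> \<le> 0" using hom[of "r * y" L "1 - L"] neg r y by (simp add: mult_nonneg_nonpos)
    finally show ?thesis using le order_trans by blast
  qed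
  have "v * h (- (r * L * y)) (r * y - r * L * y) \<le> 0"
    using left v by (simp add: mult_nonneg_nonpos)
  then have "h (0 - \<delta> * y) (y + \<delta> * y) \<le> (1 - v) * h 0 (r * y)" using leg2 by linarith
  then have "(1 - w) * h (0 - \<delta> * y) (y + \<delta> * y) \<le> (1 - w) * ((1 - v) * h 0 (r * y))"
    using w by (intro mult_left_mono) auto
  moreover have "w * h (L * y) (y - L * y) \<le> w * (y powr p * \<phi> L (1 - L))"
    using right w by (intro mult_left_mono) auto
  ultimately have "h 0 y \<le> (1 - w) * ((1 - v) * h 0 (r * y)) + w * (y powr p * \<phi> L (1 - L))"
    using leg1 by linarith
  also have "(1 - w) * ((1 - v) * h 0 (r * y)) = h 0 (r * y) / r powr p"
    using weights by (simp flip: mult.assoc)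
  finally show ?thesis by (simp add: wval)
qed

text \<open>
  As the step length of the zigzag tends to zero, its rays converge to those through
  \<open>(\<plusminus> 1/p, 1 - 1/p)\<close>, where the boundary function has to be tested.
\<close>

lemma tendsto_zigzag_slope:
  fixes p :: real
  assumes "1 < p"
  shows "((\<lambda>r. (r - 1) / 2 * (1 + r powr (p - 1)) / (r powr p - 1)) \<longlongrightarrow> 1 / p) (at_right 1)"
proof -
  have "((\<lambda>r. r powr p) has_real_derivative p * 1 powr (p - 1)) (at 1)"
    by (rule has_real_derivative_powr) simp
  then have "((\<lambda>r. (r powr p - 1) / (r - 1)) \<longlongrightarrow> p) (at 1)"
    by (simp add: has_field_derivative_iff)
  then have "((\<lambda>r. (r powr p - 1) / (r - 1)) \<longlongrightarrow> p) (at_right 1)"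
    by (rule filterlim_mono) (auto simp: at_within_le_at)
  then have "((\<lambda>r. ((1 + r powr (p - 1)) / 2) / ((r powr p - 1) / (r - 1)))
      \<longlongrightarrow> ((1 + 1 powr (p - 1)) / 2) / p) (at_right 1)"
    using assms by (intro tendsto_intros) auto
  then show ?thesis by (simp add: mult.commute)
qed

text \<open>
  Suppose that \<open>\<phi>\<close> is negative at \<open>(1/p, 1 - 1/p)\<close>. Then it is negative on the rays of all
  sufficiently fine zigzags, so that each step increases the normalised value \<open>h (0, y) / y\<^sup>p\<close> by at
  least a fixed \<open>\<beta> > 0\<close>. But homogeneity bounds this value by \<open>\<phi> 0 1\<close>.
\<close>

lemma zigzag_necessary:
  fixes h \<phi> :: "real \<Rightarrow> real \<Rightarrow> real" and p :: real
  assumes p: "1 < p"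
    and conv_plus: "\<And>x y. convex_on UNIV (\<lambda>t. h (x + t) (y + t))"
    and conv_minus: "\<And>x y. convex_on UNIV (\<lambda>t. h (x + t) (y - t))"
    and le: "\<And>x y. h x y \<le> \<phi> x y"
    and hom: "\<And>s x y. 0 < s \<Longrightarrow> \<phi> (s * x) (s * y) = s powr p * \<phi> x y"
    and even: "\<And>x y. \<phi> (- x) y = \<phi> x y"
    and cont: "isCont (\<lambda>L. \<phi> L (1 - L)) (1 / p)"
  shows "0 \<le> \<phi> (1 / p) (1 - 1 / p)"
proof (rule ccontr)
  define L where "L = (\<lambda>r. (r - 1) / 2 * (1 + r powr (p - 1)) / (r powr p - 1))"
  assume "\<not> 0 \<le> \<phi> (1 / p) (1 - 1 / p)"
  then have "\<phi> (1 / p) (1 - 1 / p) < 0" by simp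
  moreover have "((\<lambda>r. \<phi> (L r) (1 - L r)) \<longlongrightarrow> \<phi> (1 / p) (1 - 1 / p)) (at_right 1)"
    unfolding L_def by (rule isCont_tendsto_compose[OF cont tendsto_zigzag_slope[OF p]])
  ultimately have "\<forall>\<^sub>F r in at_right 1. \<phi> (L r) (1 - L r) < 0"
    by (simp add: order_tendstoD)
  moreover have "\<forall>\<^sub>F r :: real in at_right 1. 1 < r" by (simp add: eventually_at_right_less)
  ultimately have "\<forall>\<^sub>F r in at_right 1. \<phi> (L r) (1 - L r) < 0 \<and> 1 < r"
    by (rule eventually_conj)
  then obtain r where r: "\<phi> (L r) (1 - L r) < 0" "1 < r"
    using eventually_happens'[of "at_right (1::real)"] by auto
  define \<beta> where
    "\<beta> = (r powr p - 1) / (r powr (p - 1) + r powr p) * - \<phi> (L r) (1 - L r)"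
  have "1 < r powr p" using p r by (simp add: gr_one_powr)
  then have \<beta>: "0 < \<beta>" using r unfolding \<beta>_def
    by (intro mult_pos_pos divide_pos_pos add_pos_pos) auto
  define a where "a = (\<lambda>n. h 0 (r ^ n) / (r ^ n) powr p)"
  have step: "a n + \<beta> \<le> a (Suc n)" for n
  proof -
    have pos: "0 < (r ^ n) powr p" using r by simp
    have "h 0 (r ^ n) \<le> - \<beta> * (r ^ n) powr p + h 0 (r * r ^ n) / r powr p"
      using zigzag_step[OF p r(2) _ conv_plus conv_minus le hom even L_def[THEN fun_cong], of "r ^ n"] r
      by (simp add: \<beta>_def mult_ac)
    then have "a n \<le> (- \<beta> * (r ^ n) powr p + h 0 (r * r ^ n) / r powr p) / (r ^ n) powr p"
      unfolding a_def using pos by (intro divide_right_mono) auto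
    also have "\<dots> = - \<beta> + a (Suc n)"
      using pos r by (simp add: a_def diff_divide_distrib powr_mult)
    finally show ?thesis by simp
  qed
  have grow: "a 0 + real n * \<beta> \<le> a n" for n
  proof (induction n)
    case (Suc n)
    then show ?case using step[of n] by (simp add: algebra_simps)
  qed simp
  have "a n \<le> \<phi> 0 1" for n
  proof -
    have pos: "0 < r ^ n" using r by simp
    then have "0 < (r ^ n) powr p" using r by simp
    moreover have "h 0 (r ^ n) \<le> \<phi> 0 1 * (r ^ n) powr p"
      using le[of 0 "r ^ n"] hom[OF pos, of 0 1] by (simp add: mult.commute)
    ultimately show ?thesis unfolding a_def by (simp only: pos_divide_le_eq)
  qed
  moreover obtain n where "\<phi> 0 1 - a 0 < real n * \<beta>"
    using reals_Archimedean3[OF \<beta>] by blast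
  ultimately show False using grow[of n] by (smt (verit))
qed


section \<open>Convexity of Burkholder's function along lines\<close>

text \<open>
  Burkholder's function, up to a constant factor and, in the range \<open>p < 2\<close>, up to sign and an exchange
  of the two arguments.
\<close>

definition burkholder :: "real \<Rightarrow> real \<Rightarrow> real \<Rightarrow> real" where
  "burkholder p u v = ((p - 1) * u - v) * (u + v) powr (p - 1)"

lemma burkholder_deriv:
  fixes \<rho> \<sigma> \<rho>' \<sigma>' :: "real \<Rightarrow> real" and p t :: real
  assumes pos: "0 < \<rho> t" "0 < \<sigma> t"
    and d: "(\<rho> has_real_derivative \<rho>' t) (at t)" "(\<sigma> has_real_derivative \<sigma>' t) (at t)"
  shows "((\<lambda>t. burkholder p (\<rho> t) (\<sigma> t)) has_real_derivative
           p * (\<rho> t + \<sigma> t) powr (p - 2)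
             * ((p - 2) * \<rho> t * (\<rho>' t + \<sigma>' t) + (\<rho> t * \<rho>' t - \<sigma> t * \<sigma>' t))) (at t)"
proof -
  define s where "s = \<rho> t + \<sigma> t"
  have s: "0 < s" using pos by (simp add: s_def)
  have "((\<lambda>t. \<rho> t + \<sigma> t) has_real_derivative \<rho>' t + \<sigma>' t) (at t)"
    by (intro derivative_intros d)
  from DERIV_fun_powr[OF this, of "p - 1"]
  have ds: "((\<lambda>t. (\<rho> t + \<sigma> t) powr (p - 1)) has_real_derivative
      (p - 1) * s powr (p - 2) * (\<rho>' t + \<sigma>' t)) (at t)"
    using s by (simp add: s_def)
  have split: "s powr (p - 1) = s * s powr (p - 2)"
    using s powr_add[of s 1 "p - 2"] by simp
  have dl: "((\<lambda>t. (p - 1) * \<rho> t - \<sigma> t) has_real_derivative (p - 1) * \<rho>' t - \<sigma>' t) (at t)"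
    by (intro derivative_intros d DERIV_cmult)
  show ?thesis unfolding burkholder_def
    apply (rule DERIV_cong[OF DERIV_mult[OF dl ds]])
    unfolding s_def[symmetric] split unfolding s_def by algebra
qed

text \<open>
  The assumptions \<open>quad\<close> hold when \<open>\<rho>\<^sup>2\<close> and \<open>\<sigma>\<^sup>2\<close> are quadratic polynomials with leading
  coefficients \<open>A\<close> and \<open>B\<close>. The derivative is arranged so that its sign can be read off: for \<open>p \<ge> 2\<close> and
  \<open>A \<ge> B\<close> all summands are nonnegative, for \<open>1 < p \<le> 2\<close> and \<open>A \<le> B\<close> all are nonpositive, given only
  \<open>\<sigma>'' \<ge> 0\<close>.
\<close>

lemma burkholder_deriv2:
  fixes \<rho> \<sigma> \<rho>' \<sigma>' \<rho>'' \<sigma>'' :: "real \<Rightarrow> real" and p t A B :: real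
  assumes pos: "0 < \<rho> t" "0 < \<sigma> t"
    and d: "(\<rho> has_real_derivative \<rho>' t) (at t)" "(\<sigma> has_real_derivative \<sigma>' t) (at t)"
    and d2: "(\<rho>' has_real_derivative \<rho>'' t) (at t)" "(\<sigma>' has_real_derivative \<sigma>'' t) (at t)"
    and quad: "(\<rho>' t)\<^sup>2 + \<rho> t * \<rho>'' t = A" "(\<sigma>' t)\<^sup>2 + \<sigma> t * \<sigma>'' t = B"
  shows "((\<lambda>t. p * (\<rho> t + \<sigma> t) powr (p - 2)
             * ((p - 2) * \<rho> t * (\<rho>' t + \<sigma>' t) + (\<rho> t * \<rho>' t - \<sigma> t * \<sigma>' t)))
         has_real_derivative
           p * (\<rho> t + \<sigma> t) powr (p - 3)
             * ((p - 2) * ((p - 1) * \<rho> t * (\<rho>' t + \<sigma>' t)\<^sup>2 + (\<rho> t + \<sigma> t)\<^sup>2 * \<sigma>'' t)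
                + (p - 1) * (\<rho> t + \<sigma> t) * (A - B))) (at t)"
proof -
  define s where "s = \<rho> t + \<sigma> t"
  have s: "0 < s" using pos by (simp add: s_def)
  have "((\<lambda>t. \<rho> t + \<sigma> t) has_real_derivative \<rho>' t + \<sigma>' t) (at t)"
    by (intro derivative_intros d)
  from DERIV_fun_powr[OF this, of "p - 2"]
  have ds: "((\<lambda>t. (\<rho> t + \<sigma> t) powr (p - 2)) has_real_derivative
      (p - 2) * s powr (p - 3) * (\<rho>' t + \<sigma>' t)) (at t)"
    using s by (simp add: s_def)
  have split: "s powr (p - 2) = s * s powr (p - 3)"
    using s powr_add[of s 1 "p - 3"] by simp
  have D: "((\<lambda>t. (p - 2) * \<rho> t * (\<rho>' t + \<sigma>' t) + (\<rho> t * \<rho>' t - \<sigma> t * \<sigma>' t)) has_real_derivative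
     (p - 2) * \<rho>' t * (\<rho>' t + \<sigma>' t) + (p - 2) * \<rho> t * (\<rho>'' t + \<sigma>'' t) + (A - B)) (at t)"
    using quad by (auto intro!: derivative_eq_intros d d2 simp: power2_eq_square algebra_simps)
  have main: "(p - 2) * (\<rho>' t + \<sigma>' t)
        * ((p - 2) * \<rho> t * (\<rho>' t + \<sigma>' t) + (\<rho> t * \<rho>' t - \<sigma> t * \<sigma>' t))
      + s * ((p - 2) * \<rho>' t * (\<rho>' t + \<sigma>' t) + (p - 2) * \<rho> t * (\<rho>'' t + \<sigma>'' t) + (A - B))
     = (p - 2) * ((p - 1) * \<rho> t * (\<rho>' t + \<sigma>' t)\<^sup>2 + s\<^sup>2 * \<sigma>'' t) + (p - 1) * s * (A - B)"
    unfolding s_def quad[symmetric] by algebra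
  have regroup: "p * ((p - 2) * S * w) * E + E' * (p * (s * S)) = p * S * ((p - 2) * w * E + s * E')"
    for S w E E' :: real
    by algebra
  show ?thesis
    apply (rule DERIV_cong[OF DERIV_mult[OF DERIV_cmult[OF ds] D]])
    unfolding s_def[symmetric] split main[symmetric] by (rule regroup)
qed

text \<open>
  The norm is not differentiable at the origin, and a line may pass through the origin. Adding
  \<open>e\<^sup>2\<close> under the root lifts the line off the origin (it is the norm of \<open>(x + t a, e)\<close> in the product with
  \<open>\<real>\<close>) without changing the leading coefficient of the squared norm.
\<close>

lemma smoothed_norm_derivs:
  fixes x a :: "'a::real_inner" and e :: real
  assumes e: "0 < e"
  shows "\<exists>\<rho>' \<rho>''. \<forall>t.
    ((\<lambda>t. sqrt ((norm (x + t *\<^sub>R a))\<^sup>2 + e\<^sup>2)) has_real_derivative \<rho>' t) (at t) \<and>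
    (\<rho>' has_real_derivative \<rho>'' t) (at t) \<and>
    (\<rho>' t)\<^sup>2 + sqrt ((norm (x + t *\<^sub>R a))\<^sup>2 + e\<^sup>2) * \<rho>'' t = (norm a)\<^sup>2 \<and> 0 \<le> \<rho>'' t"
proof -
  define \<rho> where "\<rho> = (\<lambda>t. sqrt ((norm (x + t *\<^sub>R a))\<^sup>2 + e\<^sup>2))"
  define \<rho>' where "\<rho>' = (\<lambda>t. (x + t *\<^sub>R a) \<bullet> a / \<rho> t)"
  define \<rho>'' where "\<rho>'' = (\<lambda>t. ((norm a)\<^sup>2 - (\<rho>' t)\<^sup>2) / \<rho> t)"
  have inner_line: "(x + t *\<^sub>R a) \<bullet> a = x \<bullet> a + t * (a \<bullet> a)" for t
    by (simp add: inner_add_left)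
  have sq: "(norm (x + t *\<^sub>R a))\<^sup>2 = x \<bullet> x + 2 * t * (x \<bullet> a) + t\<^sup>2 * (a \<bullet> a)" for t
    unfolding power2_norm_eq_inner
    by (simp add: inner_add_left inner_add_right inner_commute[of a x] power2_eq_square algebra_simps)
  have arg: "0 < (norm (x + t *\<^sub>R a))\<^sup>2 + e\<^sup>2" for t using e by (simp add: add_nonneg_pos)
  then have pos: "0 < \<rho> t" for t by (simp add: \<rho>_def)
  show ?thesis
  proof (rule exI[of _ \<rho>'], rule exI[of _ \<rho>''], rule allI)
    fix t
    have "((\<lambda>t. (norm (x + t *\<^sub>R a))\<^sup>2 + e\<^sup>2) has_real_derivative 2 * ((x + t *\<^sub>R a) \<bullet> a)) (at t)"
      unfolding sq inner_line by (auto intro!: derivative_eq_intros)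
    from DERIV_chain2[OF DERIV_real_sqrt[OF arg] this]
    have d: "(\<rho> has_real_derivative \<rho>' t) (at t)"
      by (simp add: \<rho>_def \<rho>'_def field_simps)
    then have r1: "((\<lambda>t. sqrt ((norm (x + t *\<^sub>R a))\<^sup>2 + e\<^sup>2)) has_real_derivative \<rho>' t) (at t)"
      by (simp add: \<rho>_def)
    have "((\<lambda>t. (x + t *\<^sub>R a) \<bullet> a) has_real_derivative a \<bullet> a) (at t)"
      unfolding inner_line by (auto intro!: derivative_eq_intros)
    from DERIV_divide[OF this d] pos[of t]
    have "(\<rho>' has_real_derivative (a \<bullet> a * \<rho> t - (x + t *\<^sub>R a) \<bullet> a * \<rho>' t) / (\<rho> t * \<rho> t)) (at t)"
      by (simp add: \<rho>'_def)
    moreover have "(x + t *\<^sub>R a) \<bullet> a = \<rho> t * \<rho>' t" using pos[of t] by (simp add: \<rho>'_def)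
    then have "(a \<bullet> a * \<rho> t - (x + t *\<^sub>R a) \<bullet> a * \<rho>' t) / (\<rho> t * \<rho> t) = \<rho>'' t"
      using pos[of t] by (simp add: \<rho>''_def power2_norm_eq_inner) (simp add: power2_eq_square field_simps)
    ultimately have r2: "(\<rho>' has_real_derivative \<rho>'' t) (at t)" by simp
    have r3: "(\<rho>' t)\<^sup>2 + sqrt ((norm (x + t *\<^sub>R a))\<^sup>2 + e\<^sup>2) * \<rho>'' t = (norm a)\<^sup>2"
      using pos[of t] by (simp add: \<rho>''_def flip: \<rho>_def[THEN fun_cong])
    have "\<bar>(x + t *\<^sub>R a) \<bullet> a\<bar> \<le> norm (x + t *\<^sub>R a) * norm a" by (rule Cauchy_Schwarz_ineq2)
    also have "\<dots> \<le> \<rho> t * norm a"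
      unfolding \<rho>_def by (intro mult_right_mono real_le_rsqrt) auto
    finally have "\<bar>\<rho>' t\<bar> \<le> \<bar>norm a\<bar>" using pos[of t] by (simp add: \<rho>'_def pos_divide_le_eq mult.commute)
    then have "(\<rho>' t)\<^sup>2 \<le> (norm a)\<^sup>2" by (simp only: abs_le_square_iff)
    then have r4: "0 \<le> \<rho>'' t" using pos[of t] by (simp add: \<rho>''_def)
    from r1 r2 r3 r4 show "((\<lambda>t. sqrt ((norm (x + t *\<^sub>R a))\<^sup>2 + e\<^sup>2)) has_real_derivative \<rho>' t) (at t) \<and>
      (\<rho>' has_real_derivative \<rho>'' t) (at t) \<and>
      (\<rho>' t)\<^sup>2 + sqrt ((norm (x + t *\<^sub>R a))\<^sup>2 + e\<^sup>2) * \<rho>'' t = (norm a)\<^sup>2 \<and> 0 \<le> \<rho>'' t"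
      by blast
  qed
qed

lemma tendsto_burkholder_smoothed:
  fixes u v p :: real
  assumes "1 < p" "0 \<le> u" "0 \<le> v"
  shows "((\<lambda>e. burkholder p (sqrt (u\<^sup>2 + e\<^sup>2)) (sqrt (v\<^sup>2 + e\<^sup>2))) \<longlongrightarrow> burkholder p u v) (at_right 0)"
proof -
  have "((\<lambda>e. burkholder p (sqrt (u\<^sup>2 + e\<^sup>2)) (sqrt (v\<^sup>2 + e\<^sup>2)))
     \<longlongrightarrow> burkholder p (sqrt (u\<^sup>2 + 0\<^sup>2)) (sqrt (v\<^sup>2 + 0\<^sup>2))) (at_right 0)"
    unfolding burkholder_def using assms by (intro tendsto_intros tendsto_powr') auto
  then show ?thesis using assms by simp
qed

lemma convex_on_limit:
  fixes F :: "'b \<Rightarrow> 'a::real_vector \<Rightarrow> real"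
  assumes "G \<noteq> bot" and lim: "\<And>x. ((\<lambda>e. F e x) \<longlongrightarrow> f x) G"
    and conv: "\<forall>\<^sub>F e in G. convex_on S (F e)" 
  shows "convex_on S f"
proof (rule convex_onI)
  show "convex S" using eventually_happens'[OF assms(1) conv] by (auto simp: convex_on_def)
  fix t :: real and x y assume tS: "0 < t" "t < 1" "x \<in> S" "y \<in> S"
  show "f ((1 - t) *\<^sub>R x + t *\<^sub>R y) \<le> (1 - t) * f x + t * f y"
  proof (rule tendsto_le[OF assms(1)])
    show "((\<lambda>e. (1 - t) * F e x + t * F e y) \<longlongrightarrow> (1 - t) * f x + t * f y) G"
      by (intro tendsto_intros lim)
    show "\<forall>\<^sub>F e in G. F e ((1 - t) *\<^sub>R x + t *\<^sub>R y) \<le> (1 - t) * F e x + t * F e y"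
      using conv
    proof eventually_elim
      case (elim e)
      then show ?case using tS by (intro convex_onD) auto
    qed
  qed (rule lim)
qed

lemma smoothed_burkholder_second_deriv:
  fixes x a :: "'a::real_inner" and y b :: "'b::real_inner" and p e :: real
  assumes "0 < e"
  shows "\<exists>f' f''. \<forall>t.
    ((\<lambda>t. burkholder p (sqrt ((norm (x + t *\<^sub>R a))\<^sup>2 + e\<^sup>2)) (sqrt ((norm (y + t *\<^sub>R b))\<^sup>2 + e\<^sup>2)))
       has_real_derivative f' t) (at t) \<and>
    (f' has_real_derivative f'' t) (at t) \<and>
    (2 \<le> p \<and> norm b \<le> norm a \<longrightarrow> 0 \<le> f'' t) \<and>
    (1 < p \<and> p \<le> 2 \<and> norm a \<le> norm b \<longrightarrow> f'' t \<le> 0)"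
proof -
  define \<rho> where "\<rho> = (\<lambda>t. sqrt ((norm (x + t *\<^sub>R a))\<^sup>2 + e\<^sup>2))"
  define \<sigma> where "\<sigma> = (\<lambda>t. sqrt ((norm (y + t *\<^sub>R b))\<^sup>2 + e\<^sup>2))"
  obtain \<rho>' \<rho>'' where "\<forall>t. (\<rho> has_real_derivative \<rho>' t) (at t) \<and>
      (\<rho>' has_real_derivative \<rho>'' t) (at t) \<and>
      (\<rho>' t)\<^sup>2 + \<rho> t * \<rho>'' t = (norm a)\<^sup>2 \<and> 0 \<le> \<rho>'' t"
    using smoothed_norm_derivs[OF assms, of x a] unfolding \<rho>_def by blast
  then have X: "(\<rho> has_real_derivative \<rho>' t) (at t)" "(\<rho>' has_real_derivative \<rho>'' t) (at t)"
    "(\<rho>' t)\<^sup>2 + \<rho> t * \<rho>'' t = (norm a)\<^sup>2" "0 \<le> \<rho>'' t" for t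
    by blast+
  obtain \<sigma>' \<sigma>'' where "\<forall>t. (\<sigma> has_real_derivative \<sigma>' t) (at t) \<and>
      (\<sigma>' has_real_derivative \<sigma>'' t) (at t) \<and>
      (\<sigma>' t)\<^sup>2 + \<sigma> t * \<sigma>'' t = (norm b)\<^sup>2 \<and> 0 \<le> \<sigma>'' t"
    using smoothed_norm_derivs[OF assms, of y b] unfolding \<sigma>_def by blast
  then have Y: "(\<sigma> has_real_derivative \<sigma>' t) (at t)" "(\<sigma>' has_real_derivative \<sigma>'' t) (at t)"
    "(\<sigma>' t)\<^sup>2 + \<sigma> t * \<sigma>'' t = (norm b)\<^sup>2" "0 \<le> \<sigma>'' t" for t
    by blast+
  have pos: "0 < \<rho> t" "0 < \<sigma> t" for t
    using assms by (auto simp: \<rho>_def \<sigma>_def add_nonneg_pos)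
  define q where "q = (\<lambda>t. (p - 1) * \<rho> t * (\<rho>' t + \<sigma>' t)\<^sup>2 + (\<rho> t + \<sigma> t)\<^sup>2 * \<sigma>'' t)"
  define f'' where "f'' = (\<lambda>t. p * (\<rho> t + \<sigma> t) powr (p - 3)
             * ((p - 2) * q t + (p - 1) * (\<rho> t + \<sigma> t) * ((norm a)\<^sup>2 - (norm b)\<^sup>2)))"
  have q: "0 \<le> q t" if "1 < p" for t
    unfolding q_def using pos[of t] Y(4)[of t] that
    by (intro add_nonneg_nonneg mult_nonneg_nonneg) auto
  define f' where "f' = (\<lambda>t. p * (\<rho> t + \<sigma> t) powr (p - 2)
             * ((p - 2) * \<rho> t * (\<rho>' t + \<sigma>' t) + (\<rho> t * \<rho>' t - \<sigma> t * \<sigma>' t)))"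
  have d1: "((\<lambda>t. burkholder p (\<rho> t) (\<sigma> t)) has_real_derivative f' t) (at t)" for t
    unfolding f'_def by (rule burkholder_deriv[OF pos X(1) Y(1)])
  have d2: "(f' has_real_derivative f'' t) (at t)" for t
    unfolding f'_def f''_def q_def
    by (rule burkholder_deriv2[OF pos X(1) Y(1) X(2) Y(2) X(3) Y(3)])
  have nonneg: "0 \<le> f'' t" if "2 \<le> p" "norm b \<le> norm a" for t
    unfolding f''_def using that q[of t] pos[of t] power_mono[OF that(2), of 2]
    by (intro mult_nonneg_nonneg add_nonneg_nonneg) auto
  have nonpos: "f'' t \<le> 0" if "1 < p" "p \<le> 2" "norm a \<le> norm b" for t
    unfolding f''_def
  proof (rule mult_nonneg_nonpos[OF _ add_nonpos_nonpos])
    show "(p - 2) * q t \<le> 0" using that q[of t] by (simp add: mult_nonpos_nonneg)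
    show "(p - 1) * (\<rho> t + \<sigma> t) * ((norm a)\<^sup>2 - (norm b)\<^sup>2) \<le> 0"
      using that pos[of t] power_mono[OF that(3), of 2] by (intro mult_nonneg_nonpos) auto
  qed (use that in auto)
  show ?thesis
    using d1 d2 nonneg nonpos unfolding \<rho>_def \<sigma>_def by blast
qed

text \<open>
  Burkholder's convexity property for \<open>p \<ge> 2\<close>, obtained from the smoothed functions by letting \<open>e\<close>
  tend to zero.
\<close>

lemma convex_burkholder_line:
  fixes x a :: "'a::real_inner" and y b :: "'b::real_inner" and p :: real
  assumes p: "2 \<le> p" and ab: "norm b \<le> norm a"
  shows "convex_on UNIV (\<lambda>t. burkholder p (norm (x + t *\<^sub>R a)) (norm (y + t *\<^sub>R b)))"
proof (rule convex_on_limit[where G = "at_right 0"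
    and F = "\<lambda>e t. burkholder p (sqrt ((norm (x + t *\<^sub>R a))\<^sup>2 + e\<^sup>2)) (sqrt ((norm (y + t *\<^sub>R b))\<^sup>2 + e\<^sup>2))"])
  show "\<forall>\<^sub>F e in at_right 0. convex_on UNIV (\<lambda>t. burkholder p
      (sqrt ((norm (x + t *\<^sub>R a))\<^sup>2 + e\<^sup>2)) (sqrt ((norm (y + t *\<^sub>R b))\<^sup>2 + e\<^sup>2)))"
    using eventually_at_right_less[of 0]
  proof eventually_elim
    case (elim e)
    obtain f' f'' where f: "\<forall>t. ((\<lambda>t. burkholder p (sqrt ((norm (x + t *\<^sub>R a))\<^sup>2 + e\<^sup>2))
        (sqrt ((norm (y + t *\<^sub>R b))\<^sup>2 + e\<^sup>2))) has_real_derivative f' t) (at t) \<and>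
      (f' has_real_derivative f'' t) (at t) \<and> 0 \<le> f'' t"
      using smoothed_burkholder_second_deriv[OF elim, of p x a y b] p ab by blast
    then show ?case by (intro f''_ge0_imp_convex[where f' = f' and f'' = f'']) auto
  qed
qed (use p in \<open>auto intro!: tendsto_burkholder_smoothed\<close>)

text \<open>
  For \<open>p \<le> 2\<close> both the sign and the roles of the arguments are exchanged: now the second argument
  must be the faster one.
\<close>

lemma convex_neg_burkholder_line:
  fixes x a :: "'a::real_inner" and y b :: "'b::real_inner" and p :: real
  assumes p: "1 < p" "p \<le> 2" and ab: "norm a \<le> norm b"
  shows "convex_on UNIV (\<lambda>t. - burkholder p (norm (x + t *\<^sub>R a)) (norm (y + t *\<^sub>R b)))"
proof (rule convex_on_limit[where G = "at_right 0"
    and F = "\<lambda>e t. - burkholder p (sqrt ((norm (x + t *\<^sub>R a))\<^sup>2 + e\<^sup>2)) (sqrt ((norm (y + t *\<^sub>R b))\<^sup>2 + e\<^sup>2))"])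
  show "\<forall>\<^sub>F e in at_right 0. convex_on UNIV (\<lambda>t. - burkholder p
      (sqrt ((norm (x + t *\<^sub>R a))\<^sup>2 + e\<^sup>2)) (sqrt ((norm (y + t *\<^sub>R b))\<^sup>2 + e\<^sup>2)))"
    using eventually_at_right_less[of 0]
  proof eventually_elim
    case (elim e)
    obtain f' f'' where f: "\<forall>t. ((\<lambda>t. burkholder p (sqrt ((norm (x + t *\<^sub>R a))\<^sup>2 + e\<^sup>2))
        (sqrt ((norm (y + t *\<^sub>R b))\<^sup>2 + e\<^sup>2))) has_real_derivative f' t) (at t) \<and>
      (f' has_real_derivative f'' t) (at t) \<and> f'' t \<le> 0"
      using smoothed_burkholder_second_deriv[OF elim, of p x a y b] p ab by blast
    then show ?case
      by (intro f''_ge0_imp_convex[where f' = "\<lambda>t. - f' t" and f'' = "\<lambda>t. - f'' t"])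
        (auto intro!: DERIV_minus)
  qed
qed (use p in \<open>auto intro!: tendsto_minus tendsto_burkholder_smoothed\<close>)

section \<open>Burkholder's function as a minorant\<close>

text \<open>
  On the convex part, \<open>F\<close> lies above its horizontal tangent at \<open>k\<close>. On the concave part, a negative
  value, followed by the nonnegative value at \<open>z0\<close>, would force \<open>F\<close> to increase all the way up to it, so that
  \<open>F 0\<close> would be negative as well. The derivatives are required only inside the interval because the powers
  to which this is applied need not be twice differentiable at its endpoints.
\<close>

lemma nonneg_if_concave_then_convex:
  fixes F F' F'' :: "real \<Rightarrow> real" and z0 k z :: real
  assumes cont: "continuous_on {0..1} F"
    and d1: "\<And>x. 0 < x \<Longrightarrow> x < 1 \<Longrightarrow> (F has_real_derivative F' x) (at x)"
    and d2: "\<And>x. 0 < x \<Longrightarrow> x < 1 \<Longrightarrow> (F' has_real_derivative F'' x) (at x)"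
    and concave: "\<And>x. 0 < x \<Longrightarrow> x \<le> z0 \<Longrightarrow> F'' x \<le> 0"
    and convex: "\<And>x. z0 \<le> x \<Longrightarrow> x < 1 \<Longrightarrow> 0 \<le> F'' x"
    and k: "0 < z0" "z0 \<le> k" "k < 1" "F k = 0" "F' k = 0"
    and start: "0 \<le> F 0" and z: "0 \<le> z" "z \<le> 1"
  shows "0 \<le> F z"
proof -
  have mvt: "\<exists>\<xi>. a < \<xi> \<and> \<xi> < b \<and> F b - F a = (b - a) * F' \<xi>"
    if ab: "0 \<le> a" "a < b" "b \<le> 1" for a b
  proof -
    have "\<exists>l \<xi>. a < \<xi> \<and> \<xi> < b \<and> (F has_real_derivative l) (at \<xi>) \<and> F b - F a = (b - a) * l"
    proof (rule MVT)
      show "continuous_on {a..b} F" by (rule continuous_on_subset[OF cont]) (use ab in auto)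
      show "F differentiable (at x)" if "a < x" "x < b" for x
        using d1[of x] that ab by (simp add: real_differentiable_def) blast
    qed (use ab in auto)
    then obtain l \<xi> where "a < \<xi>" "\<xi> < b" "(F has_real_derivative l) (at \<xi>)" "F b - F a = (b - a) * l"
      by blast
    moreover from this have "l = F' \<xi>" using d1[of \<xi>] ab DERIV_unique by force
    ultimately show ?thesis by blast
  qed
  have mono: "F' a \<le> F' b" if "z0 \<le> a" "a \<le> b" "b < 1" for a b
  proof (rule DERIV_nonneg_imp_nondecreasing[OF that(2)])
    fix x assume "a \<le> x" "x \<le> b"
    then have "z0 \<le> x" "0 < x" "x < 1" using that k by auto
    then show "\<exists>y. (F' has_real_derivative y) (at x) \<and> 0 \<le> y" using d2 convex by blast
  qed
  have anti: "F' b \<le> F' a" if "0 < a" "a \<le> b" "b \<le> z0" for a b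
  proof (rule DERIV_nonpos_imp_nonincreasing[OF that(2)])
    fix x assume "a \<le> x" "x \<le> b"
    then have "x \<le> z0" "0 < x" "x < 1" using that k by auto
    then show "\<exists>y. (F' has_real_derivative y) (at x) \<and> y \<le> 0" using d2 concave by blast
  qed
  have right: "0 \<le> F x" if x: "z0 \<le> x" "x \<le> 1" for x
  proof (cases x k rule: linorder_cases)
    case less
    obtain \<xi> where "x < \<xi>" "\<xi> < k" "F k - F x = (k - x) * F' \<xi>" using mvt[of x k] k x less by force
    moreover from this have "F' \<xi> \<le> 0" using mono[of \<xi> k] k x by simp
    ultimately show ?thesis using k less by (smt (verit) mult_nonneg_nonpos)
  next
    case greater
    obtain \<xi> where "k < \<xi>" "\<xi> < x" "F x - F k = (x - k) * F' \<xi>" using mvt[of k x] k x greater by force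
    moreover from this have "0 \<le> F' \<xi>" using mono[of k \<xi>] k x by simp
    ultimately show ?thesis using k greater by (smt (verit) mult_nonneg_nonneg)
  qed (use k in auto)
  show ?thesis
  proof (cases "z0 \<le> z \<or> z = 0")
    case True
    then show ?thesis using right[of z] z start by auto
  next
    case False
    then have zz: "0 < z" "z < z0" using z by auto
    show ?thesis
    proof (rule ccontr)
      assume "\<not> 0 \<le> F z"
      then have Fz: "F z < 0" by simp
      obtain \<xi> where \<xi>: "z < \<xi>" "\<xi> < z0" "F z0 - F z = (z0 - z) * F' \<xi>" using mvt[of z z0] k zz by auto
      have "0 < (z0 - z) * F' \<xi>" using right[of z0] k Fz \<xi> by simp
      then have F\<xi>: "0 < F' \<xi>" using zz by (simp add: zero_less_mult_iff)
      obtain \<eta> where \<eta>: "0 < \<eta>" "\<eta> < z" "F z - F 0 = (z - 0) * F' \<eta>" using mvt[of 0 z] k zz by auto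
      have "F' \<xi> \<le> F' \<eta>" using anti[of \<eta> \<xi>] \<eta> \<xi> by simp
      then have "0 < z * F' \<eta>" using F\<xi> zz by simp
      then show False using \<eta> Fz start by simp
    qed
  qed
qed

text \<open>
  The value at \<open>z = 0\<close> of the tangent inequality below. After taking logarithms it is the
  concavity of \<open>ln\<close>, applied to \<open>p - 1\<close> as a weighted mean of \<open>1\<close> and \<open>p\<close> when \<open>p > 2\<close>, and to \<open>1\<close> as a
  weighted mean of \<open>p\<close> and \<open>p - 1\<close> when \<open>p < 2\<close>.
\<close>

lemma burkholder_constant:
  fixes p :: real
  assumes p: "1 < p"
  shows "0 \<le> (p - 2) * (p * ((p - 1) / p) powr (p - 1) - 1)"
proof -
  define \<alpha> where "\<alpha> = p * ((p - 1) / p) powr (p - 1)"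
  have \<alpha>pos: "0 < \<alpha>" using p by (simp add: \<alpha>_def)
  have ln\<alpha>: "ln \<alpha> = (p - 1) * ln (p - 1) - (p - 2) * ln p"
    using p by (simp add: \<alpha>_def ln_mult ln_powr ln_div algebra_simps)
  have concave: "(1 - t) * ln x + t * ln y \<le> ln ((1 - t) * x + t * y)"
    if "0 \<le> t" "t \<le> 1" "0 < x" "0 < y" for t x y :: real
    using concave_onD[OF ln_concave, of t x y] that by simp
  consider "p = 2" | "2 < p" | "p < 2" by linarith
  then have "0 \<le> (p - 2) * (\<alpha> - 1)"
  proof cases
    case 2
    have "(1 - (p - 2) / (p - 1)) * ln 1 + (p - 2) / (p - 1) * ln p
        \<le> ln ((1 - (p - 2) / (p - 1)) * 1 + (p - 2) / (p - 1) * p)"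
      using 2 by (intro concave) auto
    also have "(1 - (p - 2) / (p - 1)) * 1 + (p - 2) / (p - 1) * p = p - 1"
      using 2 by (simp add: field_simps)
    finally have "(p - 2) * ln p \<le> (p - 1) * ln (p - 1)" using 2 by (simp add: field_simps)
    then have "0 \<le> ln \<alpha>" by (simp add: ln\<alpha>)
    then show ?thesis using \<alpha>pos 2 by simp
  next
    case 3
    have "(1 - (p - 1)) * ln p + (p - 1) * ln (p - 1) \<le> ln ((1 - (p - 1)) * p + (p - 1) * (p - 1))"
      using p 3 by (intro concave) auto
    also have "(1 - (p - 1)) * p + (p - 1) * (p - 1) = 1" by (simp add: algebra_simps)
    finally have "ln \<alpha> \<le> 0" by (simp add: ln\<alpha> algebra_simps)
    then show ?thesis using \<alpha>pos 3 by (simp add: mult_nonpos_nonpos)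
  qed simp
  then show ?thesis by (simp add: \<alpha>_def)
qed

text \<open>
  The subtracted linear function is the tangent at \<open>1/p\<close>, the zero of
  \<open>(p - 1)\<^sup>p z\<^sup>p - (1 - z)\<^sup>p\<close>. The factor \<open>p - 2\<close> records that the inequality changes direction at
  \<open>p = 2\<close>; with it the difference \<open>F\<close> is concave and then convex for every \<open>p \<noteq> 2\<close>, with \<open>1/p\<close> in the convex
  part.
\<close>

lemma burkholder_tangent:
  fixes p z :: real
  assumes p: "1 < p" and z: "0 \<le> z" "z \<le> 1"
  shows "0 \<le> (p - 2) * ((p - 1) powr p * z powr p - (1 - z) powr p
                - p * ((p - 1) / p) powr (p - 1) * (p * z - 1))"
proof (cases "p = 2")
  case False
  define \<alpha> where "\<alpha> = p * ((p - 1) / p) powr (p - 1)"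
  define F where "F = (\<lambda>z. (p - 2) * ((p - 1) powr p * z powr p - (1 - z) powr p - \<alpha> * (p * z - 1)))"
  define F' where "F' = (\<lambda>z. (p - 2) * ((p - 1) powr p * (p * z powr (p - 1)) + p * (1 - z) powr (p - 1) - \<alpha> * p))"
  define F'' where "F'' = (\<lambda>z. (p - 2) * ((p - 1) powr p * (p * ((p - 1) * z powr (p - 2))) - p * ((p - 1) * (1 - z) powr (p - 2))))"
  \<comment> \<open>The odds \<open>z / (1 - z)\<close> at which \<open>F''\<close> changes sign; \<open>z0\<close> is the corresponding point.\<close>
  define \<tau> where "\<tau> = (p - 1) powr (- p / (p - 2))"
  have \<tau>: "0 < \<tau>" using p by (simp add: \<tau>_def)
  have \<tau>p: "\<tau> powr (p - 2) = 1 / (p - 1) powr p"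
  proof -
    have "- p / (p - 2) * (p - 2) = - p" using False by simp
    then show ?thesis by (simp only: \<tau>_def powr_powr powr_minus_divide)
  qed
  define z0 where "z0 = \<tau> / (1 + \<tau>)"
  have z0: "0 < z0" using \<tau> by (simp add: z0_def)
  have z0_odds: "x \<le> z0 \<longleftrightarrow> x / (1 - x) \<le> \<tau>" "z0 \<le> x \<longleftrightarrow> \<tau> \<le> x / (1 - x)" if "0 < x" "x < 1" for x
    using that \<tau> by (auto simp: z0_def field_simps)
  have F''_odds: "F'' x = p * (p - 1) * (p - 1) powr p * (1 - x) powr (p - 2)
      * ((p - 2) * ((x / (1 - x)) powr (p - 2) - \<tau> powr (p - 2)))" if "0 < x" "x < 1" for x
  proof -
    have "x powr (p - 2) = (x / (1 - x)) powr (p - 2) * (1 - x) powr (p - 2)"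
      using that by (simp flip: powr_mult)
    then show ?thesis using p unfolding F''_def \<tau>p by (simp add: field_simps)
  qed
  have powr_sign: "0 \<le> (p - 2) * (v powr (p - 2) - u powr (p - 2))" if "0 < u" "u \<le> v" for u v :: real
  proof (cases "2 \<le> p")
    case True
    then show ?thesis using that powr_mono2[of "p - 2" u v] by simp
  next
    case False
    then show ?thesis using that powr_mono2'[of "p - 2" u v] by (simp add: mult_nonpos_nonpos)
  qed
  have z0_less: "z0 < 1" using \<tau> by (simp add: z0_def)
  have z0_le: "z0 \<le> 1 / p"
  proof -
    have "(1 / p) / (1 - 1 / p) = (p - 1) powr (- 1)" using p by (simp add: powr_minus_divide field_simps)
    moreover have "\<tau> \<le> (p - 1) powr (- 1)"
    proof (cases "2 < p")
      case True
      then have "- p / (p - 2) \<le> - 1" by (simp add: field_simps)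
      then show ?thesis unfolding \<tau>_def using True by (intro powr_mono) auto
    next
      case F: False
      then have "- 1 \<le> - p / (p - 2)" using False p by (simp add: field_simps)
      then show ?thesis unfolding \<tau>_def using F p by (intro powr_mono') auto
    qed
    ultimately show ?thesis using z0_odds(2)[of "1 / p"] p by simp
  qed
  have "0 \<le> F z"
  proof (rule nonneg_if_concave_then_convex[where F = F and F' = F' and F'' = F'' and ?z0.0 = z0 and k = "1 / p"])
    show "continuous_on {0..1} F"
      unfolding F_def using p by (intro continuous_intros continuous_on_powr') auto
    show "(F has_real_derivative F' x) (at x)" if "0 < x" "x < 1" for x
      unfolding F_def F'_def using that
      by (auto intro!: derivative_eq_intros simp: algebra_simps)
    show "(F' has_real_derivative F'' x) (at x)" if "0 < x" "x < 1" for x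
      unfolding F''_def F'_def using that
      by (auto intro!: derivative_eq_intros simp: algebra_simps)
    show "F'' x \<le> 0" if "0 < x" "x \<le> z0" for x
    proof -
      have x1: "x < 1" using that z0_less by simp
      have "0 \<le> (p - 2) * (\<tau> powr (p - 2) - (x / (1 - x)) powr (p - 2))"
        using that x1 z0_odds(1)[of x] by (intro powr_sign) auto
      then have np: "(p - 2) * ((x / (1 - x)) powr (p - 2) - \<tau> powr (p - 2)) \<le> 0"
        by (simp add: algebra_simps)
      then show ?thesis unfolding F''_odds[OF that(1) x1] using p by (intro mult_nonneg_nonpos[OF _ np]) auto
    qed
    show "0 \<le> F'' x" if "z0 \<le> x" "x < 1" for x
    proof -
      have x0: "0 < x" using that z0 by simp
      have nn: "0 \<le> (p - 2) * ((x / (1 - x)) powr (p - 2) - \<tau> powr (p - 2))"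
        using that x0 \<tau> z0_odds(2)[of x] by (intro powr_sign) auto
      then show ?thesis unfolding F''_odds[OF x0 that(2)] using p by (intro mult_nonneg_nonneg[OF _ nn]) auto
    qed
    have comp: "1 - 1 / p = (p - 1) * (1 / p)" using p by (simp add: field_simps)
    have c1: "(1 - 1 / p) powr r = (p - 1) powr r * (1 / p) powr r" for r
      unfolding comp by (simp only: powr_mult)
    have e: "(p - 1) powr p = (p - 1) * (p - 1) powr (p - 1)" using p by (simp add: powr_diff)
    show "F (1 / p) = 0" using p unfolding F_def c1 by simp
    have "\<alpha> = p * (p - 1) powr (p - 1) * (1 / p) powr (p - 1)"
      unfolding \<alpha>_def using powr_mult[of "p - 1" "1 / p" "p - 1"] by simp
    then show "F' (1 / p) = 0" using p unfolding F'_def c1 e by (simp add: algebra_simps)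
    show "0 \<le> F 0" using burkholder_constant[OF p] by (simp add: F_def \<alpha>_def)
  qed (use z z0 z0_le p in auto)
  then show ?thesis by (simp add: F_def \<alpha>_def)
qed simp

text \<open>
  Both sides are \<open>p\<close>-homogeneous in \<open>(u, v)\<close>, so it suffices to compare them on the segment
  \<open>u + v = 1\<close>.
\<close>

lemma burkholder_majorization:
  fixes p u v :: real
  assumes p: "1 < p" and uv: "0 \<le> u" "0 \<le> v"
  shows "0 \<le> (p - 2) * ((p - 1) powr p * u powr p - v powr p
                - p * ((p - 1) / p) powr (p - 1) * burkholder p u v)"
proof (cases "u + v = 0")
  case True
  then have "u = 0" "v = 0" using uv by auto
  then show ?thesis by (simp add: burkholder_def)
next
  case False
  define s where "s = u + v"
  define z where "z = u / s"
  have s: "0 < s" using False uv by (simp add: s_def)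
  have u: "u = s * z" and v: "v = s * (1 - z)" using s by (auto simp: z_def s_def field_simps)
  have z: "0 \<le> z" "z \<le> 1" using uv s by (auto simp: z_def s_def)
  have sp: "s powr p = s * s powr (p - 1)" using s by (simp add: powr_diff)
  have B: "burkholder p u v = s powr p * (p * z - 1)"
    unfolding burkholder_def s_def[symmetric] sp unfolding u v by (simp add: algebra_simps)
  have "(p - 2) * ((p - 1) powr p * u powr p - v powr p
                - p * ((p - 1) / p) powr (p - 1) * burkholder p u v)
      = s powr p * ((p - 2) * ((p - 1) powr p * z powr p - (1 - z) powr p
                - p * ((p - 1) / p) powr (p - 1) * (p * z - 1)))"
    unfolding B unfolding u v powr_mult by (simp add: algebra_simps)
  also have "0 \<le> \<dots>" by (rule mult_nonneg_nonneg[OF _ burkholder_tangent[OF p z]]) simp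
  finally show ?thesis .
qed

section \<open>Rank-one convexity and orthogonal projections\<close>

lemma rank_scaleR:
  fixes A :: "real^'n^'m"
  assumes "k \<noteq> 0"
  shows "rank (k *\<^sub>R A) = rank A"
proof (rule antisym)
  have le: "rank (k *\<^sub>R A) \<le> rank A" for k and A :: "real^'n^'m"
  proof -
    have "k *\<^sub>R A = (k *\<^sub>R mat 1) ** A"
      by (simp add: vec_eq_iff matrix_matrix_mult_def mat_def if_distrib if_distribR cong: if_cong)
    then show ?thesis by (metis rank_mul_le_right)
  qed
  show "rank (k *\<^sub>R A) \<le> rank A" by (rule le)
  have "A = (1 / k) *\<^sub>R (k *\<^sub>R A)" using assms by simp
  then show "rank A \<le> rank (k *\<^sub>R A)" by (metis le)
qed

text \<open>
  Convexity on segments and on whole lines in rank-one directions are equivalent: every pair of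
  distinct points of such a line spans an admissible segment. The line version is a statement about
  functions of one real variable.
\<close>

lemma rank_one_convexI:
  fixes g :: "real^'n^'n \<Rightarrow> real"
  assumes "\<And>Z R. rank R = 1 \<Longrightarrow> convex_on UNIV (\<lambda>t. g (Z + t *\<^sub>R R))"
  shows "rank_one_convex g"
  unfolding rank_one_convex_def
proof (intro allI impI convex_onI)
  fix A B x y :: "real^'n^'n" and t :: real
  assume R: "rank (A - B) = 1" and t: "0 < t" "t < 1"
    and xy: "x \<in> closed_segment A B" "y \<in> closed_segment A B"
  have line: "\<exists>u. z = B + u *\<^sub>R (A - B)" if z: "z \<in> closed_segment A B" for z
  proof -
    obtain u where "z = (1 - u) *\<^sub>R A + u *\<^sub>R B" using z unfolding in_segment by blast
    then have "z = B + (1 - u) *\<^sub>R (A - B)" by (simp add: algebra_simps)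
    then show ?thesis by blast
  qed
  obtain u where u: "x = B + u *\<^sub>R (A - B)" using line xy by blast
  obtain v where v: "y = B + v *\<^sub>R (A - B)" using line xy by blast
  have "(1 - t) *\<^sub>R x + t *\<^sub>R y = B + ((1 - t) *\<^sub>R u + t *\<^sub>R v) *\<^sub>R (A - B)"
    unfolding u v by (simp add: algebra_simps)
  then show "g ((1 - t) *\<^sub>R x + t *\<^sub>R y) \<le> (1 - t) * g x + t * g y"
    using convex_onD[OF assms[OF R, of B], of t u v] t by (simp add: u v)
qed simp

lemma rank_one_convexD:
  fixes g :: "real^'n^'n \<Rightarrow> real"
  assumes g: "rank_one_convex g" and R: "rank R = 1"
  shows "convex_on UNIV (\<lambda>t. g (Z + t *\<^sub>R R))"
proof (rule convex_onI)
  fix t u v :: real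
  assume t: "0 < t" "t < 1"
  let ?A = "Z + u *\<^sub>R R" and ?B = "Z + v *\<^sub>R R"
  have line: "Z + ((1 - t) *\<^sub>R u + t *\<^sub>R v) *\<^sub>R R = (1 - t) *\<^sub>R ?A + t *\<^sub>R ?B"
    by (simp add: algebra_simps)
  show "g (Z + ((1 - t) *\<^sub>R u + t *\<^sub>R v) *\<^sub>R R) \<le> (1 - t) * g ?A + t * g ?B"
  proof (cases "u = v")
    case True
    then show ?thesis by (simp add: algebra_simps)
  next
    case False
    have "?A - ?B = (u - v) *\<^sub>R R" by (simp add: algebra_simps)
    then have "rank (?A - ?B) = 1" using False R by (simp add: rank_scaleR)
    then have "convex_on (closed_segment ?A ?B) g" using g by (simp add: rank_one_convex_def)
    then show ?thesis unfolding line by (rule convex_onD) (use t in auto)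
  qed
qed simp

lemma orth_proj_eqI:
  assumes "subspace X" "y \<in> X" "x - y \<in> orthogonal_comp X"
  shows "orth_proj X x = y"
  unfolding orth_proj_def using assms orth_proj_ex1[OF assms(1), of x] by blast

lemma orth_proj_line:
  assumes X: "subspace X"
  shows "orth_proj X (x + t *\<^sub>R a) = orth_proj X x + t *\<^sub>R orth_proj X a"
proof (rule orth_proj_eqI[OF X])
  have P: "orth_proj X z \<in> X" "z - orth_proj X z \<in> orthogonal_comp X" for z
    using theI'[OF orth_proj_ex1[OF X, of z]] unfolding orth_proj_def by auto
  show "orth_proj X x + t *\<^sub>R orth_proj X a \<in> X"
    by (intro subspace_add subspace_scale X P)
  have "(x - orth_proj X x) + t *\<^sub>R (a - orth_proj X a) \<in> orthogonal_comp X"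
    by (intro subspace_add subspace_scale subspace_orthogonal_comp P)
  then show "x + t *\<^sub>R a - (orth_proj X x + t *\<^sub>R orth_proj X a) \<in> orthogonal_comp X"
    by (simp add: algebra_simps)
qed

lemma orth_proj_frame:
  assumes X: "subspace X" and A: "A \<in> X" and B: "B \<in> orthogonal_comp X"
  shows "orth_proj X (x *\<^sub>R A + y *\<^sub>R B) = x *\<^sub>R A"
    and "orth_proj (orthogonal_comp X) (x *\<^sub>R A + y *\<^sub>R B) = y *\<^sub>R B"
proof -
  have A': "x *\<^sub>R A \<in> X" by (intro subspace_scale X A)
  have B': "y *\<^sub>R B \<in> orthogonal_comp X" by (intro subspace_scale subspace_orthogonal_comp B)
  show "orth_proj X (x *\<^sub>R A + y *\<^sub>R B) = x *\<^sub>R A"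
    by (rule orth_proj_eqI[OF X A']) (use B' in simp)
  show "orth_proj (orthogonal_comp X) (x *\<^sub>R A + y *\<^sub>R B) = y *\<^sub>R B"
    by (rule orth_proj_eqI[OF subspace_orthogonal_comp B'])
      (use A' orthogonal_comp_subset in auto)
qed


section \<open>Rank-one convex minorants and the envelope\<close>

text \<open>
  A single minorant bounds the envelope from below at all points simultaneously, so finiteness
  at one point already amounts to the existence of a minorant.
\<close>

lemma rc_envelope_real_iff:
  "(\<forall>A. \<exists>r :: real. rc_envelope f A = ereal r) \<longleftrightarrow> (\<exists>g. (\<forall>M. g M \<le> f M) \<and> rank_one_convex g)"
proof
  assume "\<exists>g. (\<forall>M. g M \<le> f M) \<and> rank_one_convex g"
  then obtain g where g: "\<forall>M. g M \<le> f M" "rank_one_convex g" by blast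
  show "\<forall>A. \<exists>r :: real. rc_envelope f A = ereal r"
  proof
    fix A
    have "ereal (g A) \<le> rc_envelope f A" unfolding rc_envelope_def using g by (intro Sup_upper) auto
    moreover have "rc_envelope f A \<le> ereal (f A)" unfolding rc_envelope_def by (intro Sup_least) auto
    ultimately show "\<exists>r. rc_envelope f A = ereal r" by (cases "rc_envelope f A") auto
  qed
next
  assume "\<forall>A. \<exists>r :: real. rc_envelope f A = ereal r"
  then obtain r where "rc_envelope f 0 = ereal r" by blast
  then have "{ereal (g 0) |g. (\<forall>M. g M \<le> f M) \<and> rank_one_convex g} \<noteq> {}"
    unfolding rc_envelope_def by (metis MInfty_neq_ereal(1) Sup_empty bot_ereal_def)
  then show "\<exists>g. (\<forall>M. g M \<le> f M) \<and> rank_one_convex g" by blast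
qed

text \<open>
  The coordinates \<open>(x, y)\<close> for \<open>x A + y c B\<close> turn \<open>A + c B\<close> and \<open>A - c B\<close> into the two diagonal directions.
  The zigzag along the \<open>y\<close>-axis yields the bound with \<open>p - 1\<close>, the zigzag along the \<open>x\<close>-axis the
  one with \<open>1 / (p - 1)\<close>.
\<close>

lemma le_if_rank_one_convex_minorant:
  fixes X :: "(real^'n^'n) set" and p c C :: real
  assumes p: "1 < p" and c: "0 < c" and X: "subspace X" and C: "0 \<le> C"
    and AB: "A \<in> X" "B \<in> orthogonal_comp X" "norm A = 1" "norm B = 1"
      "rank (A + c *\<^sub>R B) = 1" "rank (A - c *\<^sub>R B) = 1"
    and g: "rank_one_convex g"
      "\<And>M. g M \<le> C powr p * norm (orth_proj X M) powr p - norm (orth_proj (orthogonal_comp X) M) powr p"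
  shows "c * (max p (p / (p - 1)) - 1) \<le> C"
proof -
  define h where "h = (\<lambda>x y. g (x *\<^sub>R A + (c * y) *\<^sub>R B))"
  define \<phi> where "\<phi> = (\<lambda>x y :: real. C powr p * \<bar>x\<bar> powr p - (c * \<bar>y\<bar>) powr p)"
  have plus: "convex_on UNIV (\<lambda>t. h (x + t) (y + t))" for x y
  proof -
    have "h (x + t) (y + t) = g ((x *\<^sub>R A + (c * y) *\<^sub>R B) + t *\<^sub>R (A + c *\<^sub>R B))" for t
      by (simp add: h_def algebra_simps)
    then show ?thesis using rank_one_convexD[OF g(1) AB(5)] by simp
  qed
  have minus: "convex_on UNIV (\<lambda>t. h (x + t) (y - t))" for x y
  proof -
    have "h (x + t) (y - t) = g ((x *\<^sub>R A + (c * y) *\<^sub>R B) + t *\<^sub>R (A - c *\<^sub>R B))" for t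
      by (simp add: h_def algebra_simps)
    then show ?thesis using rank_one_convexD[OF g(1) AB(6)] by simp
  qed
  have minus': "convex_on UNIV (\<lambda>t. h (x - t) (y + t))" for x y
  proof -
    have R: "rank ((- 1) *\<^sub>R (A - c *\<^sub>R B)) = 1" using AB(6) by (subst rank_scaleR) auto
    have "h (x - t) (y + t) = g ((x *\<^sub>R A + (c * y) *\<^sub>R B) + t *\<^sub>R ((- 1) *\<^sub>R (A - c *\<^sub>R B)))" for t
      by (simp add: h_def algebra_simps)
    then show ?thesis using rank_one_convexD[OF g(1) R] by (simp only:)
  qed
  have le: "h x y \<le> \<phi> x y" for x y
    using g(2)[of "x *\<^sub>R A + (c * y) *\<^sub>R B"] c
    by (simp add: h_def \<phi>_def orth_proj_frame[OF X AB(1,2)] AB abs_mult)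
  have hom: "\<phi> (s * x) (s * y) = s powr p * \<phi> x y" if "0 < s" for s x y
    using that c by (simp add: \<phi>_def abs_mult powr_mult algebra_simps)
  have \<phi>_nonneg: "c * y \<le> C * x" if "0 \<le> \<phi> x y" "0 \<le> x" "0 \<le> y" for x y
  proof (rule ccontr)
    assume "\<not> c * y \<le> C * x"
    then have "(C * x) powr p < (c * y) powr p" using p C that by (intro powr_less_mono2) auto
    then show False using that by (simp add: \<phi>_def powr_mult)
  qed
  have "0 \<le> \<phi> (1 / p) (1 - 1 / p)"
    by (rule zigzag_necessary[OF p plus minus le hom])
      (use p c in \<open>auto simp: \<phi>_def intro!: continuous_intros\<close>)
  then have "c * (1 - 1 / p) \<le> C * (1 / p)" using p by (intro \<phi>_nonneg) auto
  also have "1 - 1 / p = (p - 1) / p" using p by (simp add: field_simps)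
  finally have 1: "c * (p - 1) \<le> C" using p by (simp add: divide_le_cancel)
  have "0 \<le> \<phi> (1 - 1 / p) (1 / p)"
    by (rule zigzag_necessary[where h = "\<lambda>x y. h y x" and \<phi> = "\<lambda>x y. \<phi> y x", OF p plus minus' le hom])
      (use p c in \<open>auto simp: \<phi>_def intro!: continuous_intros\<close>)
  then have "c * (1 / p) \<le> C * (1 - 1 / p)" using p by (intro \<phi>_nonneg) auto
  then have "c \<le> C * (p - 1)" using p by (simp add: field_simps)
  then have "c * (p / (p - 1) - 1) \<le> C" using p by (simp add: field_simps)
  with 1 show ?thesis by (simp add: max_def)
qed

text \<open>
  Scaling \<open>P\<^sub>X\<close> by \<open>c\<close> turns the cone condition into \<open>\<parallel>Q R\<parallel> \<le> \<parallel>P R\<parallel>\<close>. For \<open>p < 2\<close> Burkholder's function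
  enters with exchanged arguments and negative sign, and division by \<open>(p - 1)\<^sup>p\<close> normalises the
  coefficient of \<open>\<parallel>Q M\<parallel>\<^sup>p\<close> to \<open>-1\<close>.
\<close>

lemma ex_rank_one_convex_minorant:
  fixes X :: "(real^'n^'n) set" and p c C :: real
  assumes p: "1 < p" and c: "0 < c" and X: "subspace X"
    and cone: "\<And>R :: real^'n^'n. rank R = 1 \<Longrightarrow>
           norm (orth_proj X R) \<ge> 1 / c * norm (orth_proj (orthogonal_comp X) R)"
    and C: "c * (max p (p / (p - 1)) - 1) \<le> C"
  shows "\<exists>g. (\<forall>M. g M \<le> C powr p * norm (orth_proj X M) powr p
                              - norm (orth_proj (orthogonal_comp X) M) powr p) \<and> rank_one_convex g"
proof -
  define P where "P = (\<lambda>M. c *\<^sub>R orth_proj X M)"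
  define Q where "Q = orth_proj (orthogonal_comp X)"
  have lines: "P (Z + t *\<^sub>R R) = P Z + t *\<^sub>R P R" "Q (Z + t *\<^sub>R R) = Q Z + t *\<^sub>R Q R" for Z R t
    unfolding P_def Q_def orth_proj_line[OF X] orth_proj_line[OF subspace_orthogonal_comp]
    by (simp_all add: algebra_simps)
  have QP: "norm (Q R) \<le> norm (P R)" if "rank R = 1" for R
    using cone[OF that] c by (simp add: P_def Q_def field_simps)
  define \<alpha> where "\<alpha> = p * ((p - 1) / p) powr (p - 1)"
  have \<alpha>: "0 \<le> \<alpha>" using p by (simp add: \<alpha>_def)
  have below: "K powr p * norm (P M) powr p \<le> C powr p * norm (orth_proj X M) powr p"
    if "0 \<le> K" "c * K \<le> C" for K M
  proof -
    have "K powr p * norm (P M) powr p = (c * K) powr p * norm (orth_proj X M) powr p"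
      using c by (simp add: P_def powr_mult)
    also have "\<dots> \<le> C powr p * norm (orth_proj X M) powr p"
      using that c p by (intro mult_right_mono powr_mono2) auto
    finally show ?thesis .
  qed
  show ?thesis
  proof (cases "2 \<le> p")
    case True
    define g where "g = (\<lambda>M. \<alpha> * burkholder p (norm (P M)) (norm (Q M)))"
    have major: "\<alpha> * burkholder p u v \<le> (p - 1) powr p * u powr p - v powr p"
      if "0 \<le> u" "0 \<le> v" for u v
    \<comment> \<open>At \<open>p = 2\<close> both sides agree, and the factor \<open>p - 2\<close> of the majorization carries no information.\<close>
    proof (cases "p = 2")
      case True
      then show ?thesis using that by (simp add: \<alpha>_def burkholder_def power2_eq_square algebra_simps)
    next
      case False
      then show ?thesis
        using burkholder_majorization[OF p that] \<open>2 \<le> p\<close> by (simp add: \<alpha>_def zero_le_mult_iff)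
    qed
    have "g M \<le> C powr p * norm (orth_proj X M) powr p - norm (Q M) powr p" for M
    proof -
      have "c * (p - 1) \<le> c * (max p (p / (p - 1)) - 1)" using c by (intro mult_left_mono) auto
      then have "c * (p - 1) \<le> C" using C by linarith
      from below[OF _ this, of M] p major[of "norm (P M)" "norm (Q M)"]
      show ?thesis by (simp add: g_def)
    qed
    moreover have "rank_one_convex g"
    proof (rule rank_one_convexI)
      fix Z R :: "real^'n^'n"
      assume "rank R = 1"
      from convex_burkholder_line[OF True QP[OF this], of "P Z" "Q Z"]
      show "convex_on UNIV (\<lambda>t. g (Z + t *\<^sub>R R))"
        unfolding g_def lines using \<alpha> by (intro convex_on_cmul)
    qed
    ultimately show ?thesis unfolding Q_def by blast
  next
    case False
    define g where "g = (\<lambda>M. \<alpha> / (p - 1) powr p * - burkholder p (norm (Q M)) (norm (P M)))"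
    have major: "\<alpha> / (p - 1) powr p * - burkholder p v u \<le> (1 / (p - 1)) powr p * u powr p - v powr p"
      if "0 \<le> u" "0 \<le> v" for u v
    proof -
      have "(p - 1) powr p * v powr p - u powr p \<le> \<alpha> * burkholder p v u"
        using burkholder_majorization[OF p that(2,1)] False by (simp add: \<alpha>_def zero_le_mult_iff)
      then have "- (\<alpha> * burkholder p v u) / (p - 1) powr p \<le> (u powr p - (p - 1) powr p * v powr p) / (p - 1) powr p"
        by (intro divide_right_mono) auto
      also have "\<dots> = (1 / (p - 1)) powr p * u powr p - v powr p"
        using p by (simp add: powr_divide diff_divide_distrib)
      finally show ?thesis by simp
    qed
    have "g M \<le> C powr p * norm (orth_proj X M) powr p - norm (Q M) powr p" for M
    proof -
      have "1 / (p - 1) = p / (p - 1) - 1" using p by (simp add: field_simps)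
      then have "c * (1 / (p - 1)) \<le> c * (max p (p / (p - 1)) - 1)" using c by (intro mult_left_mono) auto
      then have "c * (1 / (p - 1)) \<le> C" using C by linarith
      from below[OF _ this, of M] p major[of "norm (P M)" "norm (Q M)"]
      show ?thesis by (simp add: g_def)
    qed
    moreover have "rank_one_convex g"
    proof (rule rank_one_convexI)
      fix Z R :: "real^'n^'n"
      assume "rank R = 1"
      have "p \<le> 2" using False by simp
      from convex_neg_burkholder_line[OF p this QP[OF \<open>rank R = 1\<close>], of "Q Z" "P Z"]
      show "convex_on UNIV (\<lambda>t. g (Z + t *\<^sub>R R))"
        unfolding g_def lines using \<alpha> by (intro convex_on_cmul) auto
    qed
    ultimately show ?thesis unfolding Q_def by blast
  qed
qed

theorem theorem2p2:
  fixes X :: "(real^'n^'n) set" and p c C :: real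
  assumes "1 < p" and "0 < c" and "subspace X"
    and "\<And>R :: real^'n^'n. rank R = 1 \<Longrightarrow>
           norm (orth_proj X R) \<ge> 1 / c * norm (orth_proj (orthogonal_comp X) R)"
    and "\<exists>A \<in> X. \<exists>B \<in> orthogonal_comp X. norm A = 1 \<and> norm B = 1 \<and>
           rank (A + c *\<^sub>R B) = 1 \<and> rank (A - c *\<^sub>R B) = 1"
    and "0 \<le> C"
  shows "(\<forall>A. \<exists>r :: real.
            rc_envelope (\<lambda>M. C powr p * norm (orth_proj X M) powr p
                              - norm (orth_proj (orthogonal_comp X) M) powr p) A = ereal r)
         \<longleftrightarrow> C \<ge> c * (max p (p / (p - 1)) - 1)"
  unfolding rc_envelope_real_iff
proof
  assume "\<exists>g. (\<forall>M. g M \<le> C powr p * norm (orth_proj X M) powr p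
                              - norm (orth_proj (orthogonal_comp X) M) powr p) \<and> rank_one_convex g"
  then show "c * (max p (p / (p - 1)) - 1) \<le> C"
    using assms(5) le_if_rank_one_convex_minorant[OF assms(1-3,6)] by blast
next
  assume C: "c * (max p (p / (p - 1)) - 1) \<le> C"
  show "\<exists>g. (\<forall>M. g M \<le> C powr p * norm (orth_proj X M) powr p
                              - norm (orth_proj (orthogonal_comp X) M) powr p) \<and> rank_one_convex g"
    by (rule ex_rank_one_convex_minorant[OF assms(1-3) _ C]) (rule assms(4))
qed

end
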